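(* Let $G$ be a group and $H$ a proper malnormal subgroup. For any $g\in G\setminus H$, the rings $A'\mathcal{G}_{G,H}$ and $R_{G,H}/(1-v_g)$ are isomorphic, where $(1-v_g)$ denotes the two-sided ideal generated by $1-v_g$.
   Context: $H\subset G$ is malnormal if $gHg^{-1}\cap H\ne\{1\}$ implies $g\in H$. Rings are unital, not necessarily commutative. The ring $A'\mathcal{G}_{G,H}$ is generated over $\mathbb{Z}$ by invertible elements $u_{x,y}$, $x,y\in G\setminus H$, subject to the relations: $u_{x,y}u_{y,z}=u_{x,z}$; $u_{xh,y}=u_{x,yh}=u_{hx,hy}=u_{x,y}$ for all $h\in H$; and $u_{y^{-1}x,y^{-1}}+u_{x,y}=1$ whenever $y^{-1}x\notin H$. The ring $R_{G,H}$ is generated over $\mathbb{Z}$ by $\{s_g,v_g\mid g\in G\}$ subject to: $s_1=1$, $s_xs_y=s_{xy}$ for all $x,y\in G$; $v_x=0$ if $x\in H$ and $v_x$ is invertible if $x\notin H$; $v_{xy}=v_y+v_xs_y$ for all $x,y\in G$. *)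

theory Defs
  imports "HOL-Algebra.QuotRing" "HOL-Algebra.Coset" "HOL-Library.Poly_Mapping"
begin

section \<open>Free rings and rings given by generators and relations\<close>

text \<open>
  Words, with concatenation written additively, since \<^theory>\<open>HOL-Library.Poly_Mapping\<close>
  makes the finitely supported functions on an additive monoid into the monoid ring.
  The free noncommutative unital ring over the integers is then the integral monoid ring
  of the free monoid of words.
\<close>

datatype 'x free_word = Word (letters: "'x list")

instantiation free_word :: (type) monoid_add
begin

definition zero_free_word :: "'x free_word"
  where "zero_free_word = Word []"

definition plus_free_word :: "'x free_word \<Rightarrow> 'x free_word \<Rightarrow> 'x free_word"
  where "plus_free_word v w = Word (letters v @ letters w)"

instance
  by standard (simp_all add: zero_free_word_def plus_free_word_def)

end

type_synonym 'x ncpoly = "'x free_word \<Rightarrow>\<^sub>0 int"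

definition gen :: "'x \<Rightarrow> 'x ncpoly"
  where "gen x = Poly_Mapping.single (Word [x]) 1"

definition free_ring :: "'x set \<Rightarrow> 'x ncpoly ring"
  where "free_ring X =
    \<lparr>carrier = {p. \<forall>w \<in> Poly_Mapping.keys p. set (letters w) \<subseteq> X},
     mult = (*), one = 1, zero = 0, add = (+)\<rparr>"

text \<open>
  A pair \<open>(l, r)\<close> in \<open>E\<close> stands for the relation \<open>l = r\<close>. Both sides have to lie in
  the free ring on \<open>X\<close>: otherwise no ideal contains the relators.
\<close>

definition relation_ideal :: "'x set \<Rightarrow> ('x ncpoly \<times> 'x ncpoly) set \<Rightarrow> 'x ncpoly set"
  where "relation_ideal X E = Idl\<^bsub>free_ring X\<^esub> {l - r | l r. (l, r) \<in> E}"

definition presented_ring :: "'x set \<Rightarrow> ('x ncpoly \<times> 'x ncpoly) set \<Rightarrow> 'x ncpoly set ring"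
  where "presented_ring X E = free_ring X Quot relation_ideal X E"

definition presented_gen :: "'x set \<Rightarrow> ('x ncpoly \<times> 'x ncpoly) set \<Rightarrow> 'x \<Rightarrow> 'x ncpoly set"
  where "presented_gen X E x = relation_ideal X E +>\<^bsub>free_ring X\<^esub> gen x"

lemma free_ring_simps [simp]:
  "mult (free_ring X) = (*)" "one (free_ring X) = 1"
  "zero (free_ring X) = 0" "add (free_ring X) = (+)"
  by (simp_all add: free_ring_def)

lemma carrier_free_ring:
  "p \<in> carrier (free_ring X) \<longleftrightarrow> (\<forall>w \<in> Poly_Mapping.keys p. set (letters w) \<subseteq> X)"
  by (simp add: free_ring_def)

lemma free_ring_closed [simp]:
  shows "0 \<in> carrier (free_ring X)" and "1 \<in> carrier (free_ring X)"
    and "x \<in> X \<Longrightarrow> gen x \<in> carrier (free_ring X)"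
    and "p \<in> carrier (free_ring X) \<Longrightarrow> - p \<in> carrier (free_ring X)"
    and "p \<in> carrier (free_ring X) \<Longrightarrow> q \<in> carrier (free_ring X) \<Longrightarrow> p + q \<in> carrier (free_ring X)"
    and "p \<in> carrier (free_ring X) \<Longrightarrow> q \<in> carrier (free_ring X) \<Longrightarrow> p - q \<in> carrier (free_ring X)"
    and "p \<in> carrier (free_ring X) \<Longrightarrow> q \<in> carrier (free_ring X) \<Longrightarrow> p * q \<in> carrier (free_ring X)"
proof -
  show "0 \<in> carrier (free_ring X)" "1 \<in> carrier (free_ring X)"
    "x \<in> X \<Longrightarrow> gen x \<in> carrier (free_ring X)"
    by (auto simp: carrier_free_ring gen_def zero_free_word_def)
  show minus: "- p \<in> carrier (free_ring X)" if "p \<in> carrier (free_ring X)" for p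
    using that by (simp add: carrier_free_ring)
  show plus: "p + q \<in> carrier (free_ring X)"
    if "p \<in> carrier (free_ring X)" "q \<in> carrier (free_ring X)" for p q
    using that keys_add[of p q] by (fastforce simp: carrier_free_ring)
  show "p - q \<in> carrier (free_ring X)"
    if "p \<in> carrier (free_ring X)" "q \<in> carrier (free_ring X)" for p q
    using plus[OF that(1) minus[OF that(2)]] by simp
  show "p * q \<in> carrier (free_ring X)"
    if "p \<in> carrier (free_ring X)" "q \<in> carrier (free_ring X)" for p q
    using that keys_mult[of p q] by (fastforce simp: carrier_free_ring plus_free_word_def)
qed

lemma ring_free_ring: "ring (free_ring X)"
proof (rule ringI)
  show "abelian_group (free_ring X)"
  proof (rule abelian_groupI)
    show "\<exists>q \<in> carrier (free_ring X). q \<oplus>\<^bsub>free_ring X\<^esub> p = \<zero>\<^bsub>free_ring X\<^esub>"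
      if "p \<in> carrier (free_ring X)" for p
      using that by (intro bexI[of _ "- p"]) auto
  qed (auto simp: add_ac)
  show "monoid (free_ring X)"
    by (rule monoidI) (auto simp: mult.assoc)
qed (auto simp: algebra_simps)

lemma ideal_relation_ideal:
  assumes "\<And>l r. (l, r) \<in> E \<Longrightarrow> l \<in> carrier (free_ring X) \<and> r \<in> carrier (free_ring X)"
  shows "ideal (relation_ideal X E) (free_ring X)"
  unfolding relation_ideal_def using assms
  by (intro ring.genideal_ideal[OF ring_free_ring]) auto

lemma ring_presented_ring:
  assumes "\<And>l r. (l, r) \<in> E \<Longrightarrow> l \<in> carrier (free_ring X) \<and> r \<in> carrier (free_ring X)"
  shows "ring (presented_ring X E)"
  unfolding presented_ring_def by (rule ideal.quotient_is_ring[OF ideal_relation_ideal[OF assms]])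

section \<open>Malnormal subgroups\<close>

definition malnormal :: "('a, 'b) monoid_scheme \<Rightarrow> 'a set \<Rightarrow> bool"
  where "malnormal G H \<longleftrightarrow>
    (\<forall>g \<in> carrier G. ((g <#\<^bsub>G\<^esub> H) #>\<^bsub>G\<^esub> inv\<^bsub>G\<^esub> g) \<inter> H \<noteq> {\<one>\<^bsub>G\<^esub>} \<longrightarrow> g \<in> H)"

section \<open>The ring generated by the \<open>u\<^sub>x\<^sub>,\<^sub>y\<close>\<close>

text \<open>
  In both presentations below, a generator is made invertible by adjoining a further
  generator subject to the two relations of a two-sided inverse.
\<close>

datatype 'a u_letter = GenU 'a 'a | GenUInv 'a 'a

definition AG_gens :: "('a, 'b) monoid_scheme \<Rightarrow> 'a set \<Rightarrow> 'a u_letter set"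
  where "AG_gens G H =
    {GenU x y | x y. x \<in> carrier G - H \<and> y \<in> carrier G - H} \<union>
    {GenUInv x y | x y. x \<in> carrier G - H \<and> y \<in> carrier G - H}"

definition AG_rels ::
  "('a, 'b) monoid_scheme \<Rightarrow> 'a set \<Rightarrow> ('a u_letter ncpoly \<times> 'a u_letter ncpoly) set"
  where "AG_rels G H = (let u = (\<lambda>x y. gen (GenU x y)); u' = (\<lambda>x y. gen (GenUInv x y)) in
    {(u x y * u' x y, 1) | x y. x \<in> carrier G - H \<and> y \<in> carrier G - H} \<union>
    {(u' x y * u x y, 1) | x y. x \<in> carrier G - H \<and> y \<in> carrier G - H} \<union>
    {(u x y * u y z, u x z) | x y z.
       x \<in> carrier G - H \<and> y \<in> carrier G - H \<and> z \<in> carrier G - H} \<union>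
    {(u (x \<otimes>\<^bsub>G\<^esub> h) y, u x y) | x y h. x \<in> carrier G - H \<and> y \<in> carrier G - H \<and> h \<in> H} \<union>
    {(u x (y \<otimes>\<^bsub>G\<^esub> h), u x y) | x y h. x \<in> carrier G - H \<and> y \<in> carrier G - H \<and> h \<in> H} \<union>
    {(u (h \<otimes>\<^bsub>G\<^esub> x) (h \<otimes>\<^bsub>G\<^esub> y), u x y) | x y h.
       x \<in> carrier G - H \<and> y \<in> carrier G - H \<and> h \<in> H} \<union>
    {(u (inv\<^bsub>G\<^esub> y \<otimes>\<^bsub>G\<^esub> x) (inv\<^bsub>G\<^esub> y) + u x y, 1) | x y.
       x \<in> carrier G - H \<and> y \<in> carrier G - H \<and> inv\<^bsub>G\<^esub> y \<otimes>\<^bsub>G\<^esub> x \<notin> H})"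

definition AG_ring :: "('a, 'b) monoid_scheme \<Rightarrow> 'a set \<Rightarrow> 'a u_letter ncpoly set ring"
  where "AG_ring G H = presented_ring (AG_gens G H) (AG_rels G H)"

section \<open>The ring generated by the \<open>s\<^sub>g\<close> and \<open>v\<^sub>g\<close>\<close>

datatype 'a sv_letter = GenS 'a | GenV 'a | GenVInv 'a

definition R_gens :: "('a, 'b) monoid_scheme \<Rightarrow> 'a set \<Rightarrow> 'a sv_letter set"
  where "R_gens G H =
    GenS ` carrier G \<union> GenV ` carrier G \<union> GenVInv ` (carrier G - H)"

definition R_rels ::
  "('a, 'b) monoid_scheme \<Rightarrow> 'a set \<Rightarrow> ('a sv_letter ncpoly \<times> 'a sv_letter ncpoly) set"
  where "R_rels G H = (let s = (\<lambda>x. gen (GenS x)); v = (\<lambda>x. gen (GenV x)); v' = (\<lambda>x. gen (GenVInv x)) in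
    {(s \<one>\<^bsub>G\<^esub>, 1)} \<union>
    {(s x * s y, s (x \<otimes>\<^bsub>G\<^esub> y)) | x y. x \<in> carrier G \<and> y \<in> carrier G} \<union>
    {(v x, 0) | x. x \<in> H} \<union>
    {(v x * v' x, 1) | x. x \<in> carrier G - H} \<union>
    {(v' x * v x, 1) | x. x \<in> carrier G - H} \<union>
    {(v (x \<otimes>\<^bsub>G\<^esub> y), v y + v x * s y) | x y. x \<in> carrier G \<and> y \<in> carrier G})"

definition R_ring :: "('a, 'b) monoid_scheme \<Rightarrow> 'a set \<Rightarrow> 'a sv_letter ncpoly set ring"
  where "R_ring G H = presented_ring (R_gens G H) (R_rels G H)"

definition R_v :: "('a, 'b) monoid_scheme \<Rightarrow> 'a set \<Rightarrow> 'a \<Rightarrow> 'a sv_letter ncpoly set"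
  where "R_v G H g = presented_gen (R_gens G H) (R_rels G H) (GenV g)"

section \<open>The relations are well-formed\<close>

context group
begin

lemma mult_subgroup_notin:
  assumes "subgroup H G" "h \<in> H" "x \<in> carrier G - H"
  shows "x \<otimes> h \<in> carrier G - H" and "h \<otimes> x \<in> carrier G - H"
proof -
  interpret H: subgroup H G by fact
  have c: "x \<in> carrier G" "h \<in> carrier G" "inv h \<in> H" using assms by auto
  have "x \<otimes> h \<otimes> inv h = x" "inv h \<otimes> (h \<otimes> x) = x"
    using c by (simp_all add: inv_solve_right' inv_solve_left')
  then have "x \<otimes> h \<notin> H" "h \<otimes> x \<notin> H"
    using H.m_closed[of "x \<otimes> h" "inv h"] H.m_closed[of "inv h" "h \<otimes> x"] c assms(3) by auto
  then show "x \<otimes> h \<in> carrier G - H" "h \<otimes> x \<in> carrier G - H"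
    using c by simp_all
qed

lemma inv_subgroup_notin:
  assumes "subgroup H G" "x \<in> carrier G - H"
  shows "inv x \<in> carrier G - H"
  using assms subgroup.m_inv_closed[OF assms(1), of "inv x"] by auto

lemma AG_rels_closed:
  assumes "subgroup H G" "(l, r) \<in> AG_rels G H"
  shows "l \<in> carrier (free_ring (AG_gens G H)) \<and> r \<in> carrier (free_ring (AG_gens G H))"
proof -
  have gens: "gen (GenU x y) \<in> carrier (free_ring (AG_gens G H))"
    "gen (GenUInv x y) \<in> carrier (free_ring (AG_gens G H))"
    if "x \<in> carrier G - H" "y \<in> carrier G - H" for x y
    using that by (auto simp: AG_gens_def)
  show ?thesis
    using assms(2) unfolding AG_rels_def Let_def
    by (elim UnE CollectE exE conjE)
      (simp_all add: gens mult_subgroup_notin[OF assms(1), simplified]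
        inv_subgroup_notin[OF assms(1), simplified])
qed

lemma R_rels_closed:
  assumes "subgroup H G" "(l, r) \<in> R_rels G H"
  shows "l \<in> carrier (free_ring (R_gens G H)) \<and> r \<in> carrier (free_ring (R_gens G H))"
proof -
  have "gen (GenS x) \<in> carrier (free_ring (R_gens G H))"
    "gen (GenV x) \<in> carrier (free_ring (R_gens G H))" if "x \<in> carrier G" for x
    using that by (auto simp: R_gens_def)
  moreover have "gen (GenVInv x) \<in> carrier (free_ring (R_gens G H))"
    if "x \<in> carrier G - H" for x
    using that by (auto simp: R_gens_def)
  ultimately show ?thesis
    using assms(2) subgroup.mem_carrier[OF assms(1)] unfolding R_rels_def Let_def
    by (elim UnE CollectE exE conjE) simp_all
qed

lemma ring_AG_ring: "subgroup H G \<Longrightarrow> ring (AG_ring G H)"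
  unfolding AG_ring_def by (intro ring_presented_ring AG_rels_closed)

lemma ring_R_ring: "subgroup H G \<Longrightarrow> ring (R_ring G H)"
  unfolding R_ring_def by (intro ring_presented_ring R_rels_closed)

lemma R_v_closed:
  assumes "subgroup H G" "g \<in> carrier G"
  shows "R_v G H g \<in> carrier (R_ring G H)"
  using assms
  by (auto simp: R_v_def R_ring_def presented_gen_def presented_ring_def FactRing_def
      A_RCOSETS_def' R_gens_def intro!: bexI[of _ "gen (GenV g)"])

end

end

theory Submission
  imports Defs
begin

text \<open>
  In any ring with elements \<open>s\<^sub>x\<close>, \<open>v\<^sub>x\<close> as in \<open>R\<close>, the products \<open>v\<^bsub>x\<^sup>-\<^sup>1\<^esub> v\<^bsub>y\<^sup>-\<^sup>1\<^esub>\<^sup>-\<^sup>1\<close> satisfy the relations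
  of the \<open>u\<^sub>x\<^sub>,\<^sub>y\<close>; this gives a homomorphism \<open>\<phi>\<close> from \<open>A\<close> to \<open>R\<close>. Conversely, in any ring with elements
  \<open>u\<^sub>x\<^sub>,\<^sub>y\<close>, set \<open>v\<^sub>x = u\<^bsub>x\<^sup>-\<^sup>1,g\<^sup>-\<^sup>1\<^esub>\<close> for \<open>x \<notin> H\<close> and \<open>v\<^sub>x = 0\<close> for \<open>x \<in> H\<close>. The additive relation for \<open>u\<close> says
  that \<open>v\<^sub>x\<^sup>-\<^sup>1 (v\<^sub>x\<^sub>y - v\<^sub>y)\<close> does not depend on \<open>x \<notin> H\<close>; taking it as \<open>s\<^sub>y\<close> gives a homomorphism
  \<open>\<psi>\<close> from \<open>R\<close> to \<open>A\<close> with \<open>\<psi> v\<^sub>g = 1\<close>. Then \<open>\<psi> \<circ> \<phi>\<close> is the identity and \<open>\<phi> \<circ> \<psi>\<close> is the identity modulo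
  \<open>1 - v\<^sub>g\<close>, so \<open>\<psi>\<close> is surjective with kernel the ideal generated by \<open>1 - v\<^sub>g\<close>.
\<close>

section \<open>The universal property of a presented ring\<close>

lemma update_eq_add_single:
  assumes "a \<notin> Poly_Mapping.keys f"
  shows "Poly_Mapping.update a b f = f + Poly_Mapping.single a b"
  using assms
  by (intro poly_mapping_eqI) (auto simp: lookup_add lookup_single lookup_update when_def in_keys_iff)

text \<open>A polynomial is a finite sum of integer multiples of words, and a word is a product of
  generators, so closure under the ring operations suffices. Zero needs no clause of its own, being
  \<open>1 + (- 1)\<close>.\<close>

lemma free_ring_induct [consumes 1, case_names one gen minus add mult]:
  assumes "p \<in> carrier (free_ring X)"
    and one: "P 1"
    and gen: "\<And>x. x \<in> X \<Longrightarrow> P (gen x)"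
    and minus: "\<And>p. p \<in> carrier (free_ring X) \<Longrightarrow> P p \<Longrightarrow> P (- p)"
    and add: "\<And>p q. p \<in> carrier (free_ring X) \<Longrightarrow> q \<in> carrier (free_ring X) \<Longrightarrow> P p \<Longrightarrow> P q \<Longrightarrow> P (p + q)"
    and mult: "\<And>p q. p \<in> carrier (free_ring X) \<Longrightarrow> q \<in> carrier (free_ring X) \<Longrightarrow> P p \<Longrightarrow> P q \<Longrightarrow> P (p * q)"
  shows "P p"
proof -
  have zero: "P 0"
    using add[of 1 "- 1"] minus[of 1] one by simp
  have word: "P (Poly_Mapping.single (Word xs) 1)
      \<and> Poly_Mapping.single (Word xs) 1 \<in> carrier (free_ring X)" if "set xs \<subseteq> X" for xs
    using that
  proof (induction xs)
    case Nil
    then show ?case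
      using one by (simp flip: zero_free_word_def)
  next
    case (Cons x xs)
    have "Poly_Mapping.single (Word (x # xs)) 1 = gen x * Poly_Mapping.single (Word xs) 1"
      by (simp add: gen_def mult_single plus_free_word_def)
    then show ?case
      using Cons mult gen by simp
  qed
  have single: "P (Poly_Mapping.single (Word xs) a)
      \<and> Poly_Mapping.single (Word xs) a \<in> carrier (free_ring X)" if "set xs \<subseteq> X" for xs a
  \<comment> \<open>Integer induction runs away from 0 in both directions; the downward step adds
    the negative of the word.\<close>
  proof (induction a rule: int_induct[where k = 0])
    case (step1 i)
    then show ?case
      using add word[OF that] by (simp add: single_add)
  next
    case (step2 i)
    then show ?case
      using add[of "Poly_Mapping.single (Word xs) i" "- Poly_Mapping.single (Word xs) 1"]
        minus word[OF that] by (simp add: single_diff)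
  qed (use zero in simp)
  have "p \<in> carrier (free_ring X) \<longrightarrow> P p"
  proof (induction p rule: update_induct)
    case (update f w a)
    show ?case
    proof
      assume "Poly_Mapping.update w a f \<in> carrier (free_ring X)"
      then have "f \<in> carrier (free_ring X)" "set (letters w) \<subseteq> X"
        using update by (auto simp: carrier_free_ring keys_update)
      then show "P (Poly_Mapping.update w a f)"
        using update single[of "letters w" a] add by (simp add: update_eq_add_single)
    qed
  qed (use zero in simp)
  then show ?thesis
    using assms(1) by simp
qed

lemma a_inv_free_ring:
  "p \<in> carrier (free_ring X) \<Longrightarrow> \<ominus>\<^bsub>free_ring X\<^esub> p = - p"
  using ring.is_abelian_group[OF ring_free_ring]
  by (intro abelian_group.minus_equality) auto

text \<open>The elements on which \<open>h\<close> and \<open>k\<close> agree are closed under the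
  ring operations. This is the uniqueness half of freeness.\<close>

lemma free_ring_hom_unique:
  assumes "ring S" "h \<in> ring_hom (free_ring X) S" "k \<in> ring_hom (free_ring X) S"
    and "\<And>x. x \<in> X \<Longrightarrow> h (gen x) = k (gen x)"
    and "p \<in> carrier (free_ring X)"
  shows "h p = k p"
proof -
  interpret h: ring_hom_ring "free_ring X" S h
    by (rule ring_hom_ringI2[OF ring_free_ring assms(1,2)])
  interpret k: ring_hom_ring "free_ring X" S k
    by (rule ring_hom_ringI2[OF ring_free_ring assms(1,3)])
  show ?thesis
    using assms(5)
  proof (induction p rule: free_ring_induct)
    case one
    then show ?case
      using h.hom_one k.hom_one by simp
  next
    case (minus p)
    then show ?case
      using h.hom_a_inv[of p] k.hom_a_inv[of p] by (simp add: a_inv_free_ring)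
  next
    case (add p q)
    then show ?case
      using h.hom_add[of p q] k.hom_add[of p q] by simp
  next
    case (mult p q)
    then show ?case
      using h.hom_mult[of p q] k.hom_mult[of p q] by simp
  qed (use assms(4) in simp)
qed

section \<open>Evaluation of noncommutative polynomials in a ring\<close>

definition letter_val :: "('b, 'm) ring_scheme \<Rightarrow> 'x set \<Rightarrow> ('x \<Rightarrow> 'b) \<Rightarrow> 'x \<Rightarrow> 'b"
  where "letter_val S X f x = (if x \<in> X then f x else \<zero>\<^bsub>S\<^esub>)"

definition word_val :: "('b, 'm) ring_scheme \<Rightarrow> 'x set \<Rightarrow> ('x \<Rightarrow> 'b) \<Rightarrow> 'x free_word \<Rightarrow> 'b"
  where "word_val S X f w =
    foldr (\<lambda>x a. letter_val S X f x \<otimes>\<^bsub>S\<^esub> a) (letters w) \<one>\<^bsub>S\<^esub>"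

text \<open>
  Letters outside \<open>X\<close> are sent to zero, so that the evaluation is a homomorphism on all
  polynomials and its computation rules need no side conditions.
\<close>

definition free_eval :: "('b, 'm) ring_scheme \<Rightarrow> 'x set \<Rightarrow> ('x \<Rightarrow> 'b) \<Rightarrow> 'x ncpoly \<Rightarrow> 'b"
  where "free_eval S X f p =
    (\<Oplus>\<^bsub>S\<^esub>w \<in> Poly_Mapping.keys p. [Poly_Mapping.lookup p w] \<cdot>\<^bsub>S\<^esub> word_val S X f w)"

locale free_evaluation = ring S for S (structure) +
  fixes X :: "'x set" and f :: "'x \<Rightarrow> 'a"
  assumes f_closed: "f \<in> X \<rightarrow> carrier S"
begin

lemma letter_val_closed [simp]: "letter_val S X f x \<in> carrier S"
  using f_closed by (auto simp: letter_val_def)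

lemma word_val_zero [simp]: "word_val S X f 0 = \<one>"
  by (simp add: word_val_def zero_free_word_def)

lemma foldr_letter_val_closed [simp]:
  "foldr (\<lambda>x a. letter_val S X f x \<otimes> a) xs \<one> \<in> carrier S"
  by (induction xs) auto

lemma word_val_closed [simp]: "word_val S X f w \<in> carrier S"
  by (simp add: word_val_def)

lemma word_val_add: "word_val S X f (v + w) = word_val S X f v \<otimes> word_val S X f w"
proof -
  have "foldr (\<lambda>x a. letter_val S X f x \<otimes> a) (xs @ ys) \<one>
    = foldr (\<lambda>x a. letter_val S X f x \<otimes> a) xs \<one> \<otimes> foldr (\<lambda>x a. letter_val S X f x \<otimes> a) ys \<one>" for xs ys
  proof (induction xs)
    case (Cons x xs)
    then show ?case
      by (simp add: m_assoc)
  qed simp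
  then show ?thesis
    by (simp add: word_val_def plus_free_word_def)
qed

lemma free_eval_closed [simp]: "free_eval S X f p \<in> carrier S"
  unfolding free_eval_def by (intro finsum_closed) auto

text \<open>Words outside the support contribute zero. This allows polynomials with different
  supports to be summed over one common index set.\<close>

lemma free_eval_superset:
  assumes "finite W" "Poly_Mapping.keys p \<subseteq> W"
  shows "free_eval S X f p = (\<Oplus>w \<in> W. [Poly_Mapping.lookup p w] \<cdot> word_val S X f w)"
proof -
  have "[(0::int)] \<cdot> a = \<zero>" for a
    by (simp add: add_pow_def)
  then show ?thesis
    unfolding free_eval_def using assms
    by (intro add.finprod_mono_neutral_cong_left)
      (auto simp: in_keys_iff)
qed

lemma free_eval_zero [simp]: "free_eval S X f 0 = \<zero>"
  by (simp add: free_eval_def)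

lemma free_eval_single: "free_eval S X f (Poly_Mapping.single w a) = [a] \<cdot> word_val S X f w"
  by (subst free_eval_superset[of "{w}"]) auto

lemma free_eval_one [simp]: "free_eval S X f 1 = \<one>"
  using free_eval_single[of 0 1] by simp

lemma free_eval_gen [simp]: "x \<in> X \<Longrightarrow> free_eval S X f (gen x) = f x"
  using funcset_mem[OF f_closed]
  by (simp add: gen_def free_eval_single word_val_def letter_val_def)

lemma free_eval_add [simp]: "free_eval S X f (p + q) = free_eval S X f p \<oplus> free_eval S X f q"
proof -
  let ?W = "Poly_Mapping.keys p \<union> Poly_Mapping.keys q"
  have "free_eval S X f (p + q) = (\<Oplus>w \<in> ?W. [Poly_Mapping.lookup (p + q) w] \<cdot> word_val S X f w)"
    by (rule free_eval_superset) (auto simp: keys_add)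
  also have "\<dots> = (\<Oplus>w \<in> ?W. [Poly_Mapping.lookup p w] \<cdot> word_val S X f w
      \<oplus> [Poly_Mapping.lookup q w] \<cdot> word_val S X f w)"
    by (simp add: lookup_add add.int_pow_mult)
  also have "\<dots> = free_eval S X f p \<oplus> free_eval S X f q"
    by (simp add: free_eval_superset[of ?W])
  finally show ?thesis .
qed

text \<open>Splitting off one monomial at a time, first in \<open>p\<close> and then in
  \<open>q\<close>, reduces the claim to two monomials; there concatenation of words becomes the
  product of their values, and integer multiples move through products.\<close>

lemma free_eval_mult [simp]: "free_eval S X f (p * q) = free_eval S X f p \<otimes> free_eval S X f q"
proof (induction p rule: update_induct)
  case (update p v a)
  have "free_eval S X f (Poly_Mapping.single v a * q)
    = free_eval S X f (Poly_Mapping.single v a) \<otimes> free_eval S X f q"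
  proof (induction q rule: update_induct)
    case (update q w b)
    have "free_eval S X f (Poly_Mapping.single v a * Poly_Mapping.single w b)
      = free_eval S X f (Poly_Mapping.single v a) \<otimes> free_eval S X f (Poly_Mapping.single w b)"
      by (simp add: mult_single free_eval_single word_val_add add_pow_ldistr_int add_pow_rdistr_int
          add.int_pow_pow mult.commute)
    then show ?case
      using update by (simp add: update_eq_add_single distrib_left r_distr)
  qed simp
  then show ?case
    using update by (simp add: update_eq_add_single distrib_right l_distr)
qed simp

lemma free_eval_ring_hom: "free_eval S X f \<in> ring_hom (free_ring X) S"
  by (rule ring_hom_memI) simp_all

end

section \<open>Quotients of the free ring by relations\<close>

text \<open>Since \<open>h\<close> vanishes on \<open>I\<close>, it is constant on each coset; the
  induced map sends a coset to the single value that \<open>h\<close> takes on it.\<close>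

lemma factor_through_ideal:
  assumes "ideal I R" "ring S" "h \<in> ring_hom R S" "h ` I \<subseteq> {\<zero>\<^bsub>S\<^esub>}"
  obtains k where "k \<in> ring_hom (R Quot I) S" "\<And>r. r \<in> carrier R \<Longrightarrow> k (I +>\<^bsub>R\<^esub> r) = h r"
proof
  interpret I: ideal I R by fact
  interpret h: ring_hom_ring R S h
    by (rule ring_hom_ringI2[OF I.ring_axioms assms(2,3)])
  show k: "the_elem (h ` (I +>\<^bsub>R\<^esub> r)) = h r" if r: "r \<in> carrier R" for r
  proof (rule the_elem_image_unique)
    show "I +>\<^bsub>R\<^esub> r \<noteq> {}"
      using I.a_rcos_self[OF r] by blast
    fix x assume "x \<in> I +>\<^bsub>R\<^esub> r"
    then obtain i where i: "i \<in> I" "x = i \<oplus>\<^bsub>R\<^esub> r"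
      by (auto simp: a_r_coset_def r_coset_def)
    moreover have "h i = \<zero>\<^bsub>S\<^esub>"
      using i assms(4) by blast
    ultimately show "h x = h r"
      using r I.a_Hcarr[OF i(1)] by simp
  qed
  have carr: "carrier (R Quot I) = {I +>\<^bsub>R\<^esub> r | r. r \<in> carrier R}"
    by (auto simp: FactRing_def A_RCOSETS_def')
  \<comment> \<open>Sums and products of cosets are folded back into cosets of sums and products,
    where the value of the induced map is known.\<close>
  note proj = I.rcos_ring_hom
  show "(\<lambda>C. the_elem (h ` C)) \<in> ring_hom (R Quot I) S"
    by (rule ring_hom_memI)
      (auto simp: carr k simp flip: ring_hom_mult[OF proj] ring_hom_add[OF proj] ring_hom_one[OF proj])
qed

locale ring_presentation =
  fixes X :: "'x set" and E :: "('x ncpoly \<times> 'x ncpoly) set"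
  assumes rels_closed: "(l, r) \<in> E \<Longrightarrow> l \<in> carrier (free_ring X) \<and> r \<in> carrier (free_ring X)"
begin

lemma ring_presented: "ring (presented_ring X E)"
  using rels_closed by (rule ring_presented_ring)

sublocale I: ideal "relation_ideal X E" "free_ring X"
  using rels_closed by (rule ideal_relation_ideal)

lemma carrier_presented_ring:
  "carrier (presented_ring X E) = {relation_ideal X E +>\<^bsub>free_ring X\<^esub> p | p. p \<in> carrier (free_ring X)}"
  by (auto simp: presented_ring_def FactRing_def A_RCOSETS_def')

lemma presented_gen_closed: "x \<in> X \<Longrightarrow> presented_gen X E x \<in> carrier (presented_ring X E)"
  by (auto simp: carrier_presented_ring presented_gen_def)

lemma coset_ring_hom:
  "(+>\<^bsub>free_ring X\<^esub>) (relation_ideal X E) \<in> ring_hom (free_ring X) (presented_ring X E)"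
  unfolding presented_ring_def by (rule I.rcos_ring_hom)

text \<open>The kernel of the evaluation contains every relator, hence the ideal they generate, so
  the evaluation descends to the quotient.\<close>

lemma presented_ring_lift:
  assumes "ring S" and f: "f \<in> X \<rightarrow> carrier S"
    and rels: "\<And>l r. (l, r) \<in> E \<Longrightarrow> free_eval S X f l = free_eval S X f r"
  obtains h where "h \<in> ring_hom (presented_ring X E) S"
    and "\<And>x. x \<in> X \<Longrightarrow> h (presented_gen X E x) = f x"
proof -
  interpret free_evaluation S X f
    using assms by (simp add: free_evaluation_def free_evaluation_axioms_def)
  interpret ev: ring_hom_ring "free_ring X" S "free_eval S X f"
    by (rule ring_hom_ringI2[OF ring_free_ring assms(1) free_eval_ring_hom])
  have "l - r \<in> a_kernel (free_ring X) S (free_eval S X f)" if "(l, r) \<in> E" for l r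
  proof -
    \<comment> \<open>Adding \<open>r\<close> back reduces the difference to additivity of
      \<open>free_eval\<close>; cancelling then gives zero.\<close>
    have "free_eval S X f (l - r) \<oplus>\<^bsub>S\<^esub> free_eval S X f r = free_eval S X f r"
      using rels[OF that] by (simp flip: free_eval_add)
    then show ?thesis
      using rels_closed[OF that] by (simp add: a_kernel_def' del: ev.kernel_zero)
  qed
  then have "{l - r | l r. (l, r) \<in> E} \<subseteq> a_kernel (free_ring X) S (free_eval S X f)"
    by blast
  then have "relation_ideal X E \<subseteq> a_kernel (free_ring X) S (free_eval S X f)"
    unfolding relation_ideal_def by (intro ring.genideal_minimal[OF ring_free_ring] ev.kernel_is_ideal)
  then have "free_eval S X f ` relation_ideal X E \<subseteq> {\<zero>\<^bsub>S\<^esub>}"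
    using ev.kernel_zero by blast
  from factor_through_ideal[OF I.ideal_axioms assms(1) free_eval_ring_hom this]
  obtain k where k: "k \<in> ring_hom (presented_ring X E) S"
    "\<And>p. p \<in> carrier (free_ring X) \<Longrightarrow> k (relation_ideal X E +>\<^bsub>free_ring X\<^esub> p) = free_eval S X f p"
    unfolding presented_ring_def by blast
  then show thesis
    using that[OF k(1)] by (simp add: presented_gen_def)
qed

text \<open>Composition with the projection turns this into uniqueness for the free ring.\<close>

lemma presented_ring_hom_unique:
  assumes "ring S" "h \<in> ring_hom (presented_ring X E) S" "k \<in> ring_hom (presented_ring X E) S"
    and "\<And>x. x \<in> X \<Longrightarrow> h (presented_gen X E x) = k (presented_gen X E x)"
    and "a \<in> carrier (presented_ring X E)"
  shows "h a = k a"
proof -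
  obtain p where p: "p \<in> carrier (free_ring X)" "a = relation_ideal X E +>\<^bsub>free_ring X\<^esub> p"
    using assms(5) by (auto simp: carrier_presented_ring)
  have "(h \<circ> (+>\<^bsub>free_ring X\<^esub>) (relation_ideal X E)) p = (k \<circ> (+>\<^bsub>free_ring X\<^esub>) (relation_ideal X E)) p"
    by (rule free_ring_hom_unique[OF assms(1) ring_hom_trans[OF coset_ring_hom assms(2)]
          ring_hom_trans[OF coset_ring_hom assms(3)] _ p(1)])
      (use assms(4) in \<open>simp add: presented_gen_def\<close>)
  then show ?thesis
    using p by simp
qed

text \<open>Evaluation at the presented generators is the projection itself, by uniqueness, and the
  projection identifies \<open>l\<close> with \<open>r\<close>. In terms of
  \<open>free_eval\<close>, the evaluation rules unfold a relation into an equation between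
  generators.\<close>

lemma presented_gen_relation:
  assumes "(l, r) \<in> E"
  shows "free_eval (presented_ring X E) X (presented_gen X E) l
    = free_eval (presented_ring X E) X (presented_gen X E) r"
proof -
  interpret free_evaluation "presented_ring X E" X "presented_gen X E"
    using ring_presented presented_gen_closed
    by (simp add: free_evaluation_def free_evaluation_axioms_def)
  have coset: "free_eval (presented_ring X E) X (presented_gen X E) p
    = relation_ideal X E +>\<^bsub>free_ring X\<^esub> p" if "p \<in> carrier (free_ring X)" for p
    by (rule free_ring_hom_unique[OF ring_presented free_eval_ring_hom coset_ring_hom _ that])
      (simp add: presented_gen_def)
  have lr: "l \<in> carrier (free_ring X)" "r \<in> carrier (free_ring X)"
    using rels_closed[OF assms] by auto
  have "l - r \<in> relation_ideal X E"
    unfolding relation_ideal_def using assms rels_closed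
    by (intro subsetD[OF ring.genideal_self[OF ring_free_ring]]) auto
  then have "relation_ideal X E +>\<^bsub>free_ring X\<^esub> l = relation_ideal X E +>\<^bsub>free_ring X\<^esub> r"
    using lr I.quotient_eq_iff_same_a_r_cos[OF I.ideal_axioms]
    by (simp add: a_minus_def a_inv_free_ring)
  then show ?thesis
    using coset lr by simp
qed

end

section \<open>Families satisfying the defining relations\<close>

locale ring_subgroup = ring S + G: group G + H: subgroup H G
  for S (structure) and G (structure) and H
begin

lemma inverse_unique:
  assumes "a \<in> carrier S" "b \<in> carrier S" "c \<in> carrier S" "a \<otimes>\<^bsub>S\<^esub> b = \<one>\<^bsub>S\<^esub>" "c \<otimes>\<^bsub>S\<^esub> a = \<one>\<^bsub>S\<^esub>"
  shows "b = c"
  using assms inv_unique[of c a b] by simp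

lemmas notin_subgroup =
  G.mult_subgroup_notin[OF H.subgroup_axioms, simplified]
  G.inv_subgroup_notin[OF H.subgroup_axioms, simplified]

end

text \<open>The relations of \<open>R_ring\<close> stated for elements of an arbitrary ring, so that
  their consequences apply equally in \<open>R_ring\<close>, in its quotient and in
  \<open>AG_ring\<close>. The inverses \<open>v'\<close> are part of the data.\<close>

locale sv_family = ring_subgroup +
  fixes s v v'
  assumes s_closed: "x \<in> carrier G \<Longrightarrow> s x \<in> carrier S"
    and v_closed: "x \<in> carrier G \<Longrightarrow> v x \<in> carrier S"
    and v'_closed: "x \<in> carrier G - H \<Longrightarrow> v' x \<in> carrier S"
    and s_one: "s \<one>\<^bsub>G\<^esub> = \<one>"
    and s_mult: "x \<in> carrier G \<Longrightarrow> y \<in> carrier G \<Longrightarrow> s x \<otimes> s y = s (x \<otimes>\<^bsub>G\<^esub> y)"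
    and v_zero: "x \<in> H \<Longrightarrow> v x = \<zero>"
    and v_v': "x \<in> carrier G - H \<Longrightarrow> v x \<otimes> v' x = \<one>"
    and v'_v: "x \<in> carrier G - H \<Longrightarrow> v' x \<otimes> v x = \<one>"
    and v_mult: "x \<in> carrier G \<Longrightarrow> y \<in> carrier G \<Longrightarrow> v (x \<otimes>\<^bsub>G\<^esub> y) = v y \<oplus> v x \<otimes> s y"

text \<open>The counterpart for the relations of \<open>AG_ring\<close>.\<close>

locale u_family = ring_subgroup +
  fixes u u'
  assumes u_closed: "x \<in> carrier G - H \<Longrightarrow> y \<in> carrier G - H \<Longrightarrow> u x y \<in> carrier S"
    and u'_closed: "x \<in> carrier G - H \<Longrightarrow> y \<in> carrier G - H \<Longrightarrow> u' x y \<in> carrier S"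
    and u_u': "x \<in> carrier G - H \<Longrightarrow> y \<in> carrier G - H \<Longrightarrow> u x y \<otimes> u' x y = \<one>"
    and u'_u: "x \<in> carrier G - H \<Longrightarrow> y \<in> carrier G - H \<Longrightarrow> u' x y \<otimes> u x y = \<one>"
    and u_trans: "x \<in> carrier G - H \<Longrightarrow> y \<in> carrier G - H \<Longrightarrow> z \<in> carrier G - H \<Longrightarrow>
      u x y \<otimes> u y z = u x z"
    and u_right1: "x \<in> carrier G - H \<Longrightarrow> y \<in> carrier G - H \<Longrightarrow> h \<in> H \<Longrightarrow> u (x \<otimes>\<^bsub>G\<^esub> h) y = u x y"
    and u_right2: "x \<in> carrier G - H \<Longrightarrow> y \<in> carrier G - H \<Longrightarrow> h \<in> H \<Longrightarrow> u x (y \<otimes>\<^bsub>G\<^esub> h) = u x y"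
    and u_left: "x \<in> carrier G - H \<Longrightarrow> y \<in> carrier G - H \<Longrightarrow> h \<in> H \<Longrightarrow>
      u (h \<otimes>\<^bsub>G\<^esub> x) (h \<otimes>\<^bsub>G\<^esub> y) = u x y"
    and u_add: "x \<in> carrier G - H \<Longrightarrow> y \<in> carrier G - H \<Longrightarrow> inv\<^bsub>G\<^esub> y \<otimes>\<^bsub>G\<^esub> x \<notin> H \<Longrightarrow>
      u (inv\<^bsub>G\<^esub> y \<otimes>\<^bsub>G\<^esub> x) (inv\<^bsub>G\<^esub> y) \<oplus> u x y = \<one>"

section \<open>From the relations of \<open>s\<close> and \<open>v\<close> to those of
  \<open>u\<close>\<close>

context sv_family
begin

lemma s_inv:
  assumes "x \<in> carrier G"
  shows "s x \<otimes> s (inv\<^bsub>G\<^esub> x) = \<one>" and "s (inv\<^bsub>G\<^esub> x) \<otimes> s x = \<one>"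
  using assms by (simp_all add: s_mult s_one)

text \<open>Expand \<open>v\<close> at the product of \<open>inv x\<close> and \<open>x\<close>,
  which is the identity and so has \<open>v\<close> equal to zero.\<close>

lemma v_inv:
  assumes "x \<in> carrier G"
  shows "v (inv\<^bsub>G\<^esub> x) \<otimes> s x = \<ominus> v x"
  using assms v_mult[of "inv\<^bsub>G\<^esub> x" x] v_zero[OF H.one_closed]
  by (intro minus_equality[symmetric]) (simp_all add: v_closed s_closed a_comm)

lemma v_left:
  assumes "x \<in> carrier G" "h \<in> H"
  shows "v (h \<otimes>\<^bsub>G\<^esub> x) = v x"
  using assms by (simp add: v_mult v_zero v_closed s_closed)

lemma v_right:
  assumes "x \<in> carrier G" "h \<in> H"
  shows "v (x \<otimes>\<^bsub>G\<^esub> h) = v x \<otimes> s h"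
  using assms by (simp add: v_mult v_zero v_closed s_closed)

lemma v'_unique:
  assumes "x \<in> carrier G - H" "b \<in> carrier S" "v x \<otimes> b = \<one>"
  shows "b = v' x"
  by (rule inverse_unique[where a = "v x"]) (use assms in \<open>simp_all add: v'_v v_closed v'_closed\<close>)

lemma v'_left:
  assumes "x \<in> carrier G - H" "h \<in> H"
  shows "v' (h \<otimes>\<^bsub>G\<^esub> x) = v' x"
  using assms v_v'[of "h \<otimes>\<^bsub>G\<^esub> x"] notin_subgroup
  by (intro v'_unique v'_closed) (simp_all add: v_left)

text \<open>By \<open>v_right\<close>, this is the inverse of \<open>v x\<close> times the unit
  \<open>s h\<close>.\<close>

lemma v'_right:
  assumes "x \<in> carrier G - H" "h \<in> H"
  shows "v' (x \<otimes>\<^bsub>G\<^esub> h) = s (inv\<^bsub>G\<^esub> h) \<otimes> v' x"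
proof -
  have c: "v x \<in> carrier S" "v' x \<in> carrier S" "s h \<in> carrier S" "s (inv\<^bsub>G\<^esub> h) \<in> carrier S"
    using assms by (auto simp: v_closed v'_closed s_closed)
  have "v (x \<otimes>\<^bsub>G\<^esub> h) \<otimes> (s (inv\<^bsub>G\<^esub> h) \<otimes> v' x) = v x \<otimes> (s h \<otimes> s (inv\<^bsub>G\<^esub> h)) \<otimes> v' x"
    using assms c by (simp add: v_right m_assoc)
  also have "\<dots> = \<one>"
    using assms c by (simp add: s_inv v_v')
  finally show ?thesis
    using assms c notin_subgroup by (intro v'_unique[symmetric]) auto
qed

text \<open>Expand \<open>v\<close> at \<open>g y\<close> with \<open>v g = 1\<close>. Thus
  \<open>s\<close> is determined by \<open>v\<close> once some value of \<open>v\<close> is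
  one.\<close>

lemma s_eq:
  assumes "g \<in> carrier G" "v g = \<one>" "y \<in> carrier G"
  shows "s y = v (g \<otimes>\<^bsub>G\<^esub> y) \<ominus> v y"
  using assms by (simp add: v_mult v_closed s_closed minus_eq a_ac r_neg)

text \<open>Transitivity cancels \<open>v'\<close> against \<open>v\<close> in the middle. Inversion
  turns the right translations by \<open>H\<close> into left ones, under which \<open>v\<close> and
  \<open>v'\<close> are invariant. A left translation by \<open>h\<close> inserts
  \<open>s (inv h)\<close> and \<open>s h\<close>, which cancel. The additive relation comes from
  \<open>v_mult\<close> and \<open>v_inv\<close>.\<close>

lemma u_family: "u_family S G H (\<lambda>x y. v (inv\<^bsub>G\<^esub> x) \<otimes> v' (inv\<^bsub>G\<^esub> y)) (\<lambda>x y. v (inv\<^bsub>G\<^esub> y) \<otimes> v' (inv\<^bsub>G\<^esub> x))"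
proof
  note closed = v_closed v'_closed s_closed notin_subgroup
  have trans: "v a \<otimes> v' b \<otimes> (v b \<otimes> v' c) = v a \<otimes> v' c"
    if "a \<in> carrier G - H" "b \<in> carrier G - H" "c \<in> carrier G - H" for a b c
  proof -
    have "v a \<otimes> v' b \<otimes> (v b \<otimes> v' c) = v a \<otimes> (v' b \<otimes> v b) \<otimes> v' c"
      using that by (simp add: m_assoc closed)
    then show ?thesis
      using that by (simp add: v'_v closed)
  qed
  fix x y assume x: "x \<in> carrier G - H" and y: "y \<in> carrier G - H"
  show "v (inv\<^bsub>G\<^esub> x) \<otimes> v' (inv\<^bsub>G\<^esub> y) \<in> carrier S" "v (inv\<^bsub>G\<^esub> y) \<otimes> v' (inv\<^bsub>G\<^esub> x) \<in> carrier S"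
    using x y by (simp_all add: closed)
  show "v (inv\<^bsub>G\<^esub> x) \<otimes> v' (inv\<^bsub>G\<^esub> y) \<otimes> (v (inv\<^bsub>G\<^esub> y) \<otimes> v' (inv\<^bsub>G\<^esub> x)) = \<one>"
    "v (inv\<^bsub>G\<^esub> y) \<otimes> v' (inv\<^bsub>G\<^esub> x) \<otimes> (v (inv\<^bsub>G\<^esub> x) \<otimes> v' (inv\<^bsub>G\<^esub> y)) = \<one>"
    using x y by (simp_all add: trans v_v' closed)
  show "v (inv\<^bsub>G\<^esub> x) \<otimes> v' (inv\<^bsub>G\<^esub> y) \<otimes> (v (inv\<^bsub>G\<^esub> y) \<otimes> v' (inv\<^bsub>G\<^esub> z)) = v (inv\<^bsub>G\<^esub> x) \<otimes> v' (inv\<^bsub>G\<^esub> z)"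
    if "z \<in> carrier G - H" for z
    using x y that by (simp add: trans closed)
  show "v (inv\<^bsub>G\<^esub> (x \<otimes>\<^bsub>G\<^esub> h)) \<otimes> v' (inv\<^bsub>G\<^esub> y) = v (inv\<^bsub>G\<^esub> x) \<otimes> v' (inv\<^bsub>G\<^esub> y)"
    "v (inv\<^bsub>G\<^esub> x) \<otimes> v' (inv\<^bsub>G\<^esub> (y \<otimes>\<^bsub>G\<^esub> h)) = v (inv\<^bsub>G\<^esub> x) \<otimes> v' (inv\<^bsub>G\<^esub> y)" if "h \<in> H" for h
    using x y that by (simp_all add: G.inv_mult_group v_left v'_left closed)
  show "v (inv\<^bsub>G\<^esub> (h \<otimes>\<^bsub>G\<^esub> x)) \<otimes> v' (inv\<^bsub>G\<^esub> (h \<otimes>\<^bsub>G\<^esub> y)) = v (inv\<^bsub>G\<^esub> x) \<otimes> v' (inv\<^bsub>G\<^esub> y)"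
    if h: "h \<in> H" for h
  proof -
    have "v (inv\<^bsub>G\<^esub> (h \<otimes>\<^bsub>G\<^esub> x)) \<otimes> v' (inv\<^bsub>G\<^esub> (h \<otimes>\<^bsub>G\<^esub> y))
      = v (inv\<^bsub>G\<^esub> x) \<otimes> (s (inv\<^bsub>G\<^esub> h) \<otimes> s h) \<otimes> v' (inv\<^bsub>G\<^esub> y)"
      using x y h by (simp add: G.inv_mult_group v_right v'_right closed m_assoc)
    then show ?thesis
      using x y h by (simp add: s_inv closed)
  qed
  show "v (inv\<^bsub>G\<^esub> (inv\<^bsub>G\<^esub> y \<otimes>\<^bsub>G\<^esub> x)) \<otimes> v' (inv\<^bsub>G\<^esub> (inv\<^bsub>G\<^esub> y)) \<oplus> v (inv\<^bsub>G\<^esub> x) \<otimes> v' (inv\<^bsub>G\<^esub> y) = \<one>"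
  proof -
    have c: "v y \<in> carrier S" "v' y \<in> carrier S" "s y \<in> carrier S" "v (inv\<^bsub>G\<^esub> x) \<in> carrier S"
      "v (inv\<^bsub>G\<^esub> y) \<in> carrier S" "v' (inv\<^bsub>G\<^esub> y) \<in> carrier S"
      using x y by (simp_all add: closed)
    \<comment> \<open>Multiplying \<open>v (inv y)\<close> by \<open>s y\<close> gives
      \<open>- v y\<close>, which suggests \<open>- (s y) (v' y)\<close> as the inverse of
      \<open>v (inv y)\<close>.\<close>
    have "v (inv\<^bsub>G\<^esub> y) \<otimes> \<ominus> (s y \<otimes> v' y) = \<ominus> (v (inv\<^bsub>G\<^esub> y) \<otimes> s y \<otimes> v' y)"
      using c by (simp add: r_minus m_assoc)
    also have "\<dots> = \<one>"
      using c x y by (simp add: v_inv l_minus v_v')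
    finally have v'_inv: "v' (inv\<^bsub>G\<^esub> y) = \<ominus> (s y \<otimes> v' y)"
      using c y by (intro v'_unique[symmetric]) (simp_all add: closed)
    \<comment> \<open>The inverse of \<open>inv y\<close> times \<open>x\<close> is
      \<open>inv x\<close> times \<open>y\<close>, to which \<open>v_mult\<close> applies. The
      second summand it produces is the negative of the other term of the relation.\<close>
    have "v (inv\<^bsub>G\<^esub> (inv\<^bsub>G\<^esub> y \<otimes>\<^bsub>G\<^esub> x)) \<otimes> v' (inv\<^bsub>G\<^esub> (inv\<^bsub>G\<^esub> y)) = (v y \<oplus> v (inv\<^bsub>G\<^esub> x) \<otimes> s y) \<otimes> v' y"
      using x y by (simp add: G.inv_mult_group v_mult)
    also have "\<dots> = \<one> \<oplus> v (inv\<^bsub>G\<^esub> x) \<otimes> (s y \<otimes> v' y)"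
      using c y by (simp add: l_distr m_assoc v_v')
    finally show ?thesis
      using c by (simp add: v'_inv r_minus a_assoc r_neg)
  qed
qed

end

section \<open>From the relations of \<open>u\<close> to those of \<open>s\<close> and
  \<open>v\<close>\<close>

context u_family
begin

text \<open>By transitivity \<open>u x x\<close> is an idempotent, and it is a unit.\<close>

lemma u_refl:
  assumes "x \<in> carrier G - H"
  shows "u x x = \<one>"
proof -
  have "u x x = u x x \<otimes> (u x x \<otimes> u' x x)"
    using assms by (simp add: u_u' u_closed)
  also have "\<dots> = u x x \<otimes> u x x \<otimes> u' x x"
    using assms by (simp add: m_assoc u_closed u'_closed)
  also have "\<dots> = \<one>"
    using assms by (simp add: u_trans u_u')
  finally show ?thesis .
qed

text \<open>Transitivity already makes \<open>u y x\<close> an inverse of \<open>u x y\<close>.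
  Hence a homomorphism is determined on the \<open>u'\<close> by its values on the
  \<open>u\<close>.\<close>

lemma u'_eq:
  assumes "x \<in> carrier G - H" "y \<in> carrier G - H"
  shows "u' x y = u y x"
  by (rule inverse_unique[of "u x y"])
    (use assms in \<open>simp_all add: u_closed u'_closed u'_u u_u' u_trans u_refl\<close>)

text \<open>In a ring with elements \<open>s\<close> and \<open>v\<close>, the element
  \<open>u x y\<close> is \<open>v (inv x)\<close> times the inverse of \<open>v (inv y)\<close>.
  Normalising by \<open>v g = 1\<close> leaves this formula for \<open>v x\<close>.\<close>

definition v_of_u :: "_ \<Rightarrow> _ \<Rightarrow> _" where
  "v_of_u g x = (if x \<in> H then \<zero> else u (inv\<^bsub>G\<^esub> x) (inv\<^bsub>G\<^esub> g))"

text \<open>Forced by \<open>v\<^sub>x\<^sub>y = v\<^sub>y + v\<^sub>x s\<^sub>y\<close>: the value of \<open>v\<^sub>x\<^sup>-\<^sup>1 (v\<^sub>x\<^sub>y - v\<^sub>y)\<close>, for any \<open>x \<notin> H\<close>.\<close>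

definition s_of_u :: "_ \<Rightarrow> _ \<Rightarrow> _" where
  "s_of_u g y = (if y \<in> H then u (inv\<^bsub>G\<^esub> g) (y \<otimes>\<^bsub>G\<^esub> inv\<^bsub>G\<^esub> g)
    else \<ominus> (u (inv\<^bsub>G\<^esub> g) y \<otimes> u (inv\<^bsub>G\<^esub> y) (inv\<^bsub>G\<^esub> g)))"

context
  fixes g
  assumes g: "g \<in> carrier G - H"
begin

lemma v_of_u_closed: "x \<in> carrier G \<Longrightarrow> v_of_u g x \<in> carrier S"
  using g by (simp add: v_of_u_def u_closed notin_subgroup)

lemma s_of_u_closed: "y \<in> carrier G \<Longrightarrow> s_of_u g y \<in> carrier S"
  using g by (simp add: s_of_u_def u_closed notin_subgroup)

lemma v_of_u_base: "v_of_u g g = \<one>"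
  using g by (simp add: v_of_u_def u_refl notin_subgroup)

text \<open>The cases follow which of \<open>x\<close>, \<open>y\<close> and their product lie in
  \<open>H\<close>, where \<open>v_of_u\<close> is zero. For \<open>x\<close> and \<open>y\<close>
  outside \<open>H\<close>, the base point cancels inside \<open>v_of_u g x\<close> times
  \<open>s_of_u g y\<close>; what remains is the additive relation, or its degenerate form when the
  product lies in \<open>H\<close>.\<close>

lemma v_of_u_mult:
  assumes x: "x \<in> carrier G" and y: "y \<in> carrier G"
  shows "v_of_u g (x \<otimes>\<^bsub>G\<^esub> y) = v_of_u g y \<oplus> v_of_u g x \<otimes> s_of_u g y"
proof (cases "x \<in> H")
  case True
  then have "x \<otimes>\<^bsub>G\<^esub> y \<in> H \<longleftrightarrow> y \<in> H"
    using y notin_subgroup(2)[of x y] by auto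
  then have "v_of_u g (x \<otimes>\<^bsub>G\<^esub> y) = v_of_u g y"
    using g True y by (auto simp: v_of_u_def G.inv_mult_group u_right1 notin_subgroup)
  then show ?thesis
    using True y by (simp add: v_of_u_def[of g x] v_of_u_closed s_of_u_closed)
next
  case nx: False
  let ?\<gamma> = "inv\<^bsub>G\<^esub> g" and ?x = "inv\<^bsub>G\<^esub> x" and ?y = "inv\<^bsub>G\<^esub> y"
  have \<gamma>: "?\<gamma> \<in> carrier G - H" and x': "?x \<in> carrier G - H"
    using g x nx by (simp_all add: notin_subgroup)
  show ?thesis
  proof (cases "y \<in> H")
    case True
    \<comment> \<open>Translating both arguments on the left by \<open>y\<close>, an element of
      \<open>H\<close>, removes \<open>inv y\<close> from the first one.\<close>
    have "u (?y \<otimes>\<^bsub>G\<^esub> ?x) ?\<gamma> = u (y \<otimes>\<^bsub>G\<^esub> (?y \<otimes>\<^bsub>G\<^esub> ?x)) (y \<otimes>\<^bsub>G\<^esub> ?\<gamma>)"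
      using x' \<gamma> True by (intro u_left[symmetric]) (simp_all add: notin_subgroup)
    also have "\<dots> = u ?x (y \<otimes>\<^bsub>G\<^esub> ?\<gamma>)"
      using x y by (simp add: G.inv_solve_left' flip: G.m_assoc)
    also have "\<dots> = u ?x ?\<gamma> \<otimes> u ?\<gamma> (y \<otimes>\<^bsub>G\<^esub> ?\<gamma>)"
      using x' \<gamma> True by (simp add: u_trans notin_subgroup)
    finally show ?thesis
      using x y nx True x' \<gamma>
      by (simp add: v_of_u_def s_of_u_def notin_subgroup G.inv_mult_group u_closed)
  next
    case ny: False
    have y': "?y \<in> carrier G - H"
      using y ny by (simp add: notin_subgroup)
    have c: "u ?x y \<in> carrier S" "u ?y ?\<gamma> \<in> carrier S" "u ?x ?\<gamma> \<in> carrier S" "u ?\<gamma> y \<in> carrier S"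
      using x' \<gamma> y ny y' by (simp_all add: u_closed)
    have "v_of_u g x \<otimes> s_of_u g y = \<ominus> (u ?x ?\<gamma> \<otimes> u ?\<gamma> y \<otimes> u ?y ?\<gamma>)"
      using nx ny c by (simp add: v_of_u_def s_of_u_def r_minus m_assoc)
    also have "\<dots> = \<ominus> (u ?x y \<otimes> u ?y ?\<gamma>)"
      using x' \<gamma> y ny by (simp add: u_trans)
    finally have rhs: "v_of_u g x \<otimes> s_of_u g y = \<ominus> (u ?x y \<otimes> u ?y ?\<gamma>)" .
    show ?thesis
    proof (cases "x \<otimes>\<^bsub>G\<^esub> y \<in> H")
      case True
      \<comment> \<open>Here \<open>y\<close> lies in the coset of \<open>inv x\<close> by
        \<open>H\<close>, so right invariance replaces it by \<open>inv x\<close>.\<close>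
      have "u ?x y = u ?x (?x \<otimes>\<^bsub>G\<^esub> (x \<otimes>\<^bsub>G\<^esub> y))"
        using x y by (simp flip: G.m_assoc)
      also have "\<dots> = \<one>"
        using x' True by (simp only: u_right2 u_refl)
      finally show ?thesis
        using rhs True ny c by (simp add: v_of_u_def[of g "x \<otimes>\<^bsub>G\<^esub> y"] v_of_u_def[of g y] r_neg)
    next
      case False
      have yx: "?y \<otimes>\<^bsub>G\<^esub> ?x \<in> carrier G - H"
        using notin_subgroup(3)[of "x \<otimes>\<^bsub>G\<^esub> y"] False x y by (simp add: G.inv_mult_group)
      have c': "u (?y \<otimes>\<^bsub>G\<^esub> ?x) ?y \<in> carrier S"
        using yx y' by (simp add: u_closed)
      \<comment> \<open>The additive relation at the pair \<open>inv x\<close>, \<open>y\<close>;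
        its side condition says that the inverse of the product of \<open>x\<close> and
        \<open>y\<close> is outside \<open>H\<close>.\<close>
      have "u (?y \<otimes>\<^bsub>G\<^esub> ?x) ?y \<oplus> u ?x y = \<one>"
        using u_add[of ?x y] x' y ny yx by simp
      then have eq: "u (?y \<otimes>\<^bsub>G\<^esub> ?x) ?y = \<one> \<oplus> \<ominus> u ?x y"
        using c c' by (metis a_assoc a_inv_closed r_neg r_zero)
      \<comment> \<open>Multiplying on the right by \<open>u (inv y) (inv g)\<close> moves the
        second argument to the base point.\<close>
      have "u (?y \<otimes>\<^bsub>G\<^esub> ?x) ?\<gamma> = u (?y \<otimes>\<^bsub>G\<^esub> ?x) ?y \<otimes> u ?y ?\<gamma>"
        using yx y' \<gamma> by (simp add: u_trans)
      also have "\<dots> = u ?y ?\<gamma> \<oplus> \<ominus> (u ?x y \<otimes> u ?y ?\<gamma>)"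
        using c by (simp add: eq l_distr l_minus)
      finally show ?thesis
        using rhs False ny x y by (simp add: v_of_u_def[of g "x \<otimes>\<^bsub>G\<^esub> y"] v_of_u_def[of g y] G.inv_mult_group)
    qed
  qed
qed

text \<open>Multiplicativity of \<open>s\<close> needs no case distinction: with
  \<open>v g = 1\<close> it follows from \<open>v_of_u_mult\<close> and associativity in
  \<open>G\<close>.\<close>

lemma sv_family: "sv_family S G H (s_of_u g) (v_of_u g) (\<lambda>x. u (inv\<^bsub>G\<^esub> g) (inv\<^bsub>G\<^esub> x))"
proof
  have gc: "g \<in> carrier G" and \<gamma>: "inv\<^bsub>G\<^esub> g \<in> carrier G - H"
    using g by (simp_all add: notin_subgroup)
  note closed = v_of_u_closed s_of_u_closed
  show "s_of_u g x \<otimes> s_of_u g y = s_of_u g (x \<otimes>\<^bsub>G\<^esub> y)" if x: "x \<in> carrier G" and y: "y \<in> carrier G" for x y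
  proof -
    \<comment> \<open>The value at \<open>g x y\<close> is expanded with both bracketings;
      cancelling the common terms leaves \<open>s (x y)\<close> on one side and the product of
      \<open>s x\<close> and \<open>s y\<close> on the other.\<close>
    have "v_of_u g y \<oplus> (v_of_u g x \<otimes> s_of_u g y \<oplus> s_of_u g (x \<otimes>\<^bsub>G\<^esub> y)) = v_of_u g (g \<otimes>\<^bsub>G\<^esub> (x \<otimes>\<^bsub>G\<^esub> y))"
      using x y gc by (simp add: v_of_u_mult v_of_u_base closed a_assoc)
    also have "\<dots> = v_of_u g (g \<otimes>\<^bsub>G\<^esub> x \<otimes>\<^bsub>G\<^esub> y)"
      using x y gc by (simp add: G.m_assoc)
    also have "\<dots> = v_of_u g y \<oplus> (v_of_u g x \<otimes> s_of_u g y \<oplus> s_of_u g x \<otimes> s_of_u g y)"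
      using x y gc by (simp add: v_of_u_mult[of "g \<otimes>\<^bsub>G\<^esub> x"] v_of_u_mult[of g x] v_of_u_base closed l_distr)
    finally show ?thesis
      using x y by (simp add: closed)
  qed
  show "v_of_u g (x \<otimes>\<^bsub>G\<^esub> y) = v_of_u g y \<oplus> v_of_u g x \<otimes> s_of_u g y"
    if "x \<in> carrier G" "y \<in> carrier G" for x y
    using that by (rule v_of_u_mult)
  show "s_of_u g \<one>\<^bsub>G\<^esub> = \<one>"
    using gc \<gamma> by (simp add: s_of_u_def u_refl)
qed (use g in \<open>auto simp: v_of_u_closed s_of_u_closed u_closed u_trans u_refl v_of_u_def notin_subgroup\<close>)

end

end

section \<open>The two presented rings\<close>

abbreviation R_s :: "('a, 'b) monoid_scheme \<Rightarrow> 'a set \<Rightarrow> 'a \<Rightarrow> 'a sv_letter ncpoly set"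
  where "R_s G H x \<equiv> presented_gen (R_gens G H) (R_rels G H) (GenS x)"

abbreviation R_v' :: "('a, 'b) monoid_scheme \<Rightarrow> 'a set \<Rightarrow> 'a \<Rightarrow> 'a sv_letter ncpoly set"
  where "R_v' G H x \<equiv> presented_gen (R_gens G H) (R_rels G H) (GenVInv x)"

abbreviation AG_u :: "('a, 'b) monoid_scheme \<Rightarrow> 'a set \<Rightarrow> 'a \<Rightarrow> 'a \<Rightarrow> 'a u_letter ncpoly set"
  where "AG_u G H x y \<equiv> presented_gen (AG_gens G H) (AG_rels G H) (GenU x y)"

abbreviation AG_u' :: "('a, 'b) monoid_scheme \<Rightarrow> 'a set \<Rightarrow> 'a \<Rightarrow> 'a \<Rightarrow> 'a u_letter ncpoly set"
  where "AG_u' G H x y \<equiv> presented_gen (AG_gens G H) (AG_rels G H) (GenUInv x y)"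

section \<open>Universal properties of the two rings in terms of families\<close>

lemma ring_presentation_R:
  "group G \<Longrightarrow> subgroup H G \<Longrightarrow> ring_presentation (R_gens G H) (R_rels G H)"
  by (intro ring_presentation.intro group.R_rels_closed)

lemma ring_presentation_AG:
  "group G \<Longrightarrow> subgroup H G \<Longrightarrow> ring_presentation (AG_gens G H) (AG_rels G H)"
  by (intro ring_presentation.intro group.AG_rels_closed)

lemma sv_family_R_ring:
  assumes "group G" "subgroup H G"
  shows "sv_family (R_ring G H) G H (R_s G H) (R_v G H) (R_v' G H)"
proof -
  interpret G: group G by fact
  interpret H: subgroup H G by fact
  interpret P: ring_presentation "R_gens G H" "R_rels G H"
    using assms by (rule ring_presentation_R)
  interpret free_evaluation "R_ring G H" "R_gens G H" "presented_gen (R_gens G H) (R_rels G H)"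
    unfolding R_ring_def using P.ring_presented P.presented_gen_closed
    by (simp add: free_evaluation_def free_evaluation_axioms_def)
  have gens: "x \<in> carrier G \<Longrightarrow> GenS x \<in> R_gens G H" "x \<in> carrier G \<Longrightarrow> GenV x \<in> R_gens G H"
    "x \<in> carrier G - H \<Longrightarrow> GenVInv x \<in> R_gens G H" for x
    by (auto simp: R_gens_def)
  note rel = P.presented_gen_relation[folded R_ring_def]
  note closed = P.presented_gen_closed[folded R_ring_def]
  show ?thesis
  proof (unfold_locales, goal_cases)
    case 4
    have "(gen (GenS \<one>\<^bsub>G\<^esub>), 1) \<in> R_rels G H"
      unfolding R_rels_def Let_def by blast
    from rel[OF this] show ?case
      by (simp add: gens)
  next
    case (5 x y)
    then have "(gen (GenS x) * gen (GenS y), gen (GenS (x \<otimes>\<^bsub>G\<^esub> y))) \<in> R_rels G H"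
      unfolding R_rels_def Let_def by blast
    from rel[OF this] show ?case
      using 5 by (simp add: gens)
  next
    case (6 x)
    then have "(gen (GenV x), 0) \<in> R_rels G H"
      unfolding R_rels_def Let_def by blast
    from rel[OF this] show ?case
      using 6 by (simp add: gens R_v_def)
  next
    case (7 x)
    then have "(gen (GenV x) * gen (GenVInv x), 1) \<in> R_rels G H"
      unfolding R_rels_def Let_def by blast
    from rel[OF this] show ?case
      using 7 by (simp add: gens R_v_def)
  next
    case (8 x)
    then have "(gen (GenVInv x) * gen (GenV x), 1) \<in> R_rels G H"
      unfolding R_rels_def Let_def by blast
    from rel[OF this] show ?case
      using 8 by (simp add: gens R_v_def)
  next
    case (9 x y)
    then have "(gen (GenV (x \<otimes>\<^bsub>G\<^esub> y)), gen (GenV y) + gen (GenV x) * gen (GenS y)) \<in> R_rels G H"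
      unfolding R_rels_def Let_def by blast
    from rel[OF this] show ?case
      using 9 by (simp add: gens R_v_def)
  qed (simp_all add: R_v_def closed gens)
qed

lemma u_family_AG_ring:
  assumes "group G" "subgroup H G"
  shows "u_family (AG_ring G H) G H (AG_u G H) (AG_u' G H)"
proof -
  interpret G: group G by fact
  interpret H: subgroup H G by fact
  interpret P: ring_presentation "AG_gens G H" "AG_rels G H"
    using assms by (rule ring_presentation_AG)
  interpret free_evaluation "AG_ring G H" "AG_gens G H" "presented_gen (AG_gens G H) (AG_rels G H)"
    unfolding AG_ring_def using P.ring_presented P.presented_gen_closed
    by (simp add: free_evaluation_def free_evaluation_axioms_def)
  have gens: "GenU x y \<in> AG_gens G H" "GenUInv x y \<in> AG_gens G H"
    if "x \<in> carrier G - H" "y \<in> carrier G - H" for x y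
    using that by (auto simp: AG_gens_def)
  note rel = P.presented_gen_relation[folded AG_ring_def]
  note closed = P.presented_gen_closed[folded AG_ring_def]
  note notin = G.mult_subgroup_notin[OF assms(2)] G.inv_subgroup_notin[OF assms(2)]
  show ?thesis
  proof (unfold_locales, goal_cases)
    case (3 x y)
    then have "(gen (GenU x y) * gen (GenUInv x y), 1) \<in> AG_rels G H"
      unfolding AG_rels_def Let_def by blast
    from rel[OF this] show ?case
      using 3 by (simp only: free_eval_mult free_eval_one free_eval_gen gens)
  next
    case (4 x y)
    then have "(gen (GenUInv x y) * gen (GenU x y), 1) \<in> AG_rels G H"
      unfolding AG_rels_def Let_def by blast
    from rel[OF this] show ?case
      using 4 by (simp only: free_eval_mult free_eval_one free_eval_gen gens)
  next
    case (5 x y z)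
    then have "(gen (GenU x y) * gen (GenU y z), gen (GenU x z)) \<in> AG_rels G H"
      unfolding AG_rels_def Let_def by blast
    from rel[OF this] show ?case
      using 5 by (simp only: free_eval_mult free_eval_gen gens)
  next
    case (6 x y h)
    then have "(gen (GenU (x \<otimes>\<^bsub>G\<^esub> h) y), gen (GenU x y)) \<in> AG_rels G H"
      unfolding AG_rels_def Let_def by blast
    from rel[OF this] show ?case
      using 6 by (simp only: free_eval_gen gens notin)
  next
    case (7 x y h)
    then have "(gen (GenU x (y \<otimes>\<^bsub>G\<^esub> h)), gen (GenU x y)) \<in> AG_rels G H"
      unfolding AG_rels_def Let_def by blast
    from rel[OF this] show ?case
      using 7 by (simp only: free_eval_gen gens notin)
  next
    case (8 x y h)
    then have "(gen (GenU (h \<otimes>\<^bsub>G\<^esub> x) (h \<otimes>\<^bsub>G\<^esub> y)), gen (GenU x y)) \<in> AG_rels G H"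
      unfolding AG_rels_def Let_def by blast
    from rel[OF this] show ?case
      using 8 by (simp only: free_eval_gen gens notin)
  next
    case (9 x y)
    then have yx: "inv\<^bsub>G\<^esub> y \<otimes>\<^bsub>G\<^esub> x \<in> carrier G - H"
      by simp
    from 9 have "(gen (GenU (inv\<^bsub>G\<^esub> y \<otimes>\<^bsub>G\<^esub> x) (inv\<^bsub>G\<^esub> y)) + gen (GenU x y), 1) \<in> AG_rels G H"
      unfolding AG_rels_def Let_def by blast
    from rel[OF this] show ?case
      using 9 gens[OF yx notin(3)[OF 9(2)]]
      by (simp only: free_eval_add free_eval_one free_eval_gen gens)
  qed (simp_all add: closed gens)
qed

context sv_family
begin

text \<open>Existence half of the universal property of \<open>R_ring\<close>: the axioms of the
  family say that evaluating the generators in it respects every relation.\<close>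

lemma obtain_hom:
  obtains h where "h \<in> ring_hom (R_ring G H) S"
    and "\<And>x. x \<in> carrier G \<Longrightarrow> h (R_s G H x) = s x"
    and "\<And>x. x \<in> carrier G \<Longrightarrow> h (R_v G H x) = v x"
    and "\<And>x. x \<in> carrier G - H \<Longrightarrow> h (R_v' G H x) = v' x"
proof -
  interpret P: ring_presentation "R_gens G H" "R_rels G H"
    using G.group_axioms H.subgroup_axioms by (rule ring_presentation_R)
  define f where "f l = (case l of GenS x \<Rightarrow> s x | GenV x \<Rightarrow> v x | GenVInv x \<Rightarrow> v' x)" for l
  have f_simps: "f (GenS x) = s x" "f (GenV x) = v x" "f (GenVInv x) = v' x" for x
    by (simp_all add: f_def)
  have f_closed: "f \<in> R_gens G H \<rightarrow> carrier S"
    by (auto simp: R_gens_def f_simps s_closed v_closed v'_closed)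
  interpret free_evaluation S "R_gens G H" f
    using f_closed by unfold_locales
  have gens: "x \<in> carrier G \<Longrightarrow> GenS x \<in> R_gens G H" "x \<in> carrier G \<Longrightarrow> GenV x \<in> R_gens G H"
    "x \<in> carrier G \<and> x \<notin> H \<Longrightarrow> GenVInv x \<in> R_gens G H" for x
    by (auto simp: R_gens_def)
  have "free_eval S (R_gens G H) f l = free_eval S (R_gens G H) f r" if "(l, r) \<in> R_rels G H" for l r
    using that unfolding R_rels_def Let_def
    by (elim UnE CollectE exE conjE)
      (simp_all add: gens f_simps s_one s_mult v_zero v_v' v'_v v_mult)
  from P.presented_ring_lift[OF ring_axioms f_closed this]
  obtain h where "h \<in> ring_hom (R_ring G H) S"
    "\<And>l. l \<in> R_gens G H \<Longrightarrow> h (presented_gen (R_gens G H) (R_rels G H) l) = f l"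
    unfolding R_ring_def by blast
  then show thesis
    by (intro that[of h]) (simp_all add: gens f_simps R_v_def)
qed

text \<open>The axioms are ring equations, which homomorphisms preserve. Through this, consequences
  of the axioms become available for the values of a homomorphism.\<close>

lemma image:
  assumes "ring T" "h \<in> ring_hom S T"
  shows "sv_family T G H (h \<circ> s) (h \<circ> v) (h \<circ> v')"
proof -
  interpret T: ring T by fact
  interpret h: ring_hom_ring S T h
    by (rule ring_hom_ringI2[OF ring_axioms assms])
  show ?thesis
    by unfold_locales
      (simp_all add: s_closed v_closed v'_closed s_one s_mult v_zero v_v' v'_v v_mult
        flip: h.hom_mult h.hom_add)
qed

end

context u_family
begin

lemma obtain_hom:
  obtains h where "h \<in> ring_hom (AG_ring G H) S"
    and "\<And>x y. x \<in> carrier G - H \<Longrightarrow> y \<in> carrier G - H \<Longrightarrow> h (AG_u G H x y) = u x y"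
    and "\<And>x y. x \<in> carrier G - H \<Longrightarrow> y \<in> carrier G - H \<Longrightarrow> h (AG_u' G H x y) = u' x y"
proof -
  interpret P: ring_presentation "AG_gens G H" "AG_rels G H"
    using G.group_axioms H.subgroup_axioms by (rule ring_presentation_AG)
  define f where "f l = (case l of GenU x y \<Rightarrow> u x y | GenUInv x y \<Rightarrow> u' x y)" for l
  have f_simps: "f (GenU x y) = u x y" "f (GenUInv x y) = u' x y" for x y
    by (simp_all add: f_def)
  have f_closed: "f \<in> AG_gens G H \<rightarrow> carrier S"
    by (auto simp: AG_gens_def f_simps u_closed u'_closed)
  interpret free_evaluation S "AG_gens G H" f
    using f_closed by unfold_locales
  have gens: "GenU x y \<in> AG_gens G H" "GenUInv x y \<in> AG_gens G H"
    if "x \<in> carrier G \<and> x \<notin> H" "y \<in> carrier G \<and> y \<notin> H" for x y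
    using that by (auto simp: AG_gens_def)
  have "free_eval S (AG_gens G H) f l = free_eval S (AG_gens G H) f r" if "(l, r) \<in> AG_rels G H" for l r
    using that unfolding AG_rels_def Let_def
    by (elim UnE CollectE exE conjE)
      (simp_all add: gens f_simps u_u' u'_u u_trans u_right1 u_right2 u_left u_add notin_subgroup)
  from P.presented_ring_lift[OF ring_axioms f_closed this]
  obtain h where "h \<in> ring_hom (AG_ring G H) S"
    "\<And>l. l \<in> AG_gens G H \<Longrightarrow> h (presented_gen (AG_gens G H) (AG_rels G H) l) = f l"
    unfolding AG_ring_def by blast
  then show thesis
    by (intro that[of h]) (simp_all add: gens f_simps)
qed

lemma image:
  assumes "ring T" "h \<in> ring_hom S T"
  shows "u_family T G H (\<lambda>x y. h (u x y)) (\<lambda>x y. h (u' x y))"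
proof -
  interpret T: ring T by fact
  interpret h: ring_hom_ring S T h
    by (rule ring_hom_ringI2[OF ring_axioms assms])
  show ?thesis
    by unfold_locales
      (simp_all add: u_closed u'_closed u_u' u'_u u_trans u_right1 u_right2 u_left u_add notin_subgroup
        flip: h.hom_mult h.hom_add)
qed

end

text \<open>Given that the image of \<open>R_v G H g\<close> is one, the values of \<open>v\<close>
  outside \<open>H\<close> determine the rest: \<open>v\<close> is zero on \<open>H\<close>,
  \<open>s\<close> is recovered by \<open>s_eq\<close>, and the \<open>v'\<close> are
  inverses.\<close>

lemma R_ring_hom_unique:
  assumes "group G" "subgroup H G" "ring S" "h \<in> ring_hom (R_ring G H) S" "k \<in> ring_hom (R_ring G H) S"
    and eq: "\<And>x. x \<in> carrier G - H \<Longrightarrow> h (R_v G H x) = k (R_v G H x)"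
    and g: "g \<in> carrier G" "k (R_v G H g) = \<one>\<^bsub>S\<^esub>" "h (R_v G H g) = \<one>\<^bsub>S\<^esub>"
    and "r \<in> carrier (R_ring G H)"
  shows "h r = k r"
proof -
  interpret P: ring_presentation "R_gens G H" "R_rels G H"
    using assms(1,2) by (rule ring_presentation_R)
  interpret R: sv_family "R_ring G H" G H "R_s G H" "R_v G H" "R_v' G H"
    using assms(1,2) by (rule sv_family_R_ring)
  interpret h: sv_family S G H "h \<circ> R_s G H" "h \<circ> R_v G H" "h \<circ> R_v' G H"
    using assms(3,4) by (rule R.image)
  interpret k: sv_family S G H "k \<circ> R_s G H" "k \<circ> R_v G H" "k \<circ> R_v' G H"
    using assms(3,5) by (rule R.image)
  have v: "h (R_v G H x) = k (R_v G H x)" if "x \<in> carrier G" for x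
    using that eq[of x] h.v_zero[of x] k.v_zero[of x] by (cases "x \<in> H") auto
  have s: "h (R_s G H x) = k (R_s G H x)" if "x \<in> carrier G" for x
    using that g v h.s_eq[of g x] k.s_eq[of g x] by simp
  have v': "h (R_v' G H x) = k (R_v' G H x)" if "x \<in> carrier G - H" for x
    using that k.v'_unique[of x "h (R_v' G H x)"] h.v_v'[of x] h.v'_closed[of x] v by simp
  show ?thesis
  proof (rule P.presented_ring_hom_unique[OF assms(3), folded R_ring_def, OF assms(4,5) _ assms(10)])
    fix l assume "l \<in> R_gens G H"
    then show "h (presented_gen (R_gens G H) (R_rels G H) l) = k (presented_gen (R_gens G H) (R_rels G H) l)"
      using v[unfolded R_v_def] s v' by (auto simp: R_gens_def)
  qed
qed

lemma AG_ring_hom_unique: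
  assumes "group G" "subgroup H G" "ring S" "h \<in> ring_hom (AG_ring G H) S" "k \<in> ring_hom (AG_ring G H) S"
    and eq: "\<And>x y. x \<in> carrier G - H \<Longrightarrow> y \<in> carrier G - H \<Longrightarrow> h (AG_u G H x y) = k (AG_u G H x y)"
    and "a \<in> carrier (AG_ring G H)"
  shows "h a = k a"
proof -
  interpret P: ring_presentation "AG_gens G H" "AG_rels G H"
    using assms(1,2) by (rule ring_presentation_AG)
  interpret A: u_family "AG_ring G H" G H "AG_u G H" "AG_u' G H"
    using assms(1,2) by (rule u_family_AG_ring)
  interpret h: u_family S G H "\<lambda>x y. h (AG_u G H x y)" "\<lambda>x y. h (AG_u' G H x y)"
    using assms(3,4) by (rule A.image)
  interpret k: u_family S G H "\<lambda>x y. k (AG_u G H x y)" "\<lambda>x y. k (AG_u' G H x y)"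
    using assms(3,5) by (rule A.image)
  show ?thesis
  proof (rule P.presented_ring_hom_unique[OF assms(3), folded AG_ring_def, OF assms(4,5) _ assms(7)])
    fix l assume "l \<in> AG_gens G H"
    then show "h (presented_gen (AG_gens G H) (AG_rels G H) l) = k (presented_gen (AG_gens G H) (AG_rels G H) l)"
      using eq h.u'_eq k.u'_eq by (auto simp: AG_gens_def)
  qed
qed

section \<open>The two homomorphisms and the isomorphism\<close>

theorem corollary3:
  fixes G :: "('a, 'b) monoid_scheme" and H :: "'a set" and g :: 'a
  assumes "group G"
    and "subgroup H G"
    and "H \<noteq> carrier G"
    and "malnormal G H"
    and "g \<in> carrier G - H"
  shows "AG_ring G H \<simeq>
    R_ring G H Quot Idl\<^bsub>R_ring G H\<^esub> {\<one>\<^bsub>R_ring G H\<^esub> \<ominus>\<^bsub>R_ring G H\<^esub> R_v G H g}"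
proof -
  let ?R = "R_ring G H" and ?A = "AG_ring G H"
  define J where "J = Idl\<^bsub>?R\<^esub> {\<one>\<^bsub>?R\<^esub> \<ominus>\<^bsub>?R\<^esub> R_v G H g}"
  have g: "g \<in> carrier G" "g \<notin> H" and g': "inv\<^bsub>G\<^esub> g \<in> carrier G - H"
    using assms(5) group.inv_subgroup_notin[OF assms(1,2)] by auto
  interpret R: sv_family ?R G H "R_s G H" "R_v G H" "R_v' G H"
    using assms(1,2) by (rule sv_family_R_ring)
  interpret A: u_family ?A G H "AG_u G H" "AG_u' G H"
    using assms(1,2) by (rule u_family_AG_ring)
  interpret RA: u_family ?R G H "\<lambda>x y. R_v G H (inv\<^bsub>G\<^esub> x) \<otimes>\<^bsub>?R\<^esub> R_v' G H (inv\<^bsub>G\<^esub> y)"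
    "\<lambda>x y. R_v G H (inv\<^bsub>G\<^esub> y) \<otimes>\<^bsub>?R\<^esub> R_v' G H (inv\<^bsub>G\<^esub> x)"
    by (rule R.u_family)
  interpret AR: sv_family ?A G H "A.s_of_u g" "A.v_of_u g" "\<lambda>x. AG_u G H (inv\<^bsub>G\<^esub> g) (inv\<^bsub>G\<^esub> x)"
    using assms(5) by (rule A.sv_family)
  obtain \<phi> where \<phi>: "\<phi> \<in> ring_hom ?A ?R"
    "\<And>x y. x \<in> carrier G - H \<Longrightarrow> y \<in> carrier G - H \<Longrightarrow>
      \<phi> (AG_u G H x y) = R_v G H (inv\<^bsub>G\<^esub> x) \<otimes>\<^bsub>?R\<^esub> R_v' G H (inv\<^bsub>G\<^esub> y)"
    by (rule RA.obtain_hom) (rule that)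
  obtain \<psi> where \<psi>: "\<psi> \<in> ring_hom ?R ?A"
    "\<And>x. x \<in> carrier G \<Longrightarrow> \<psi> (R_s G H x) = A.s_of_u g x"
    "\<And>x. x \<in> carrier G \<Longrightarrow> \<psi> (R_v G H x) = A.v_of_u g x"
    "\<And>x. x \<in> carrier G - H \<Longrightarrow> \<psi> (R_v' G H x) = AG_u G H (inv\<^bsub>G\<^esub> g) (inv\<^bsub>G\<^esub> x)"
    by (rule AR.obtain_hom) (rule that)
  interpret \<psi>: ring_hom_ring ?R ?A \<psi>
    by (rule ring_hom_ringI2[OF R.ring_axioms A.ring_axioms \<psi>(1)])
  have \<psi>\<phi>: "(\<psi> \<circ> \<phi>) a = id a" if "a \<in> carrier ?A" for a
  proof (rule AG_ring_hom_unique[OF assms(1,2) A.ring_axioms ring_hom_trans[OF \<phi>(1) \<psi>(1)] _ _ that])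
    show "id \<in> ring_hom ?A ?A"
      by (rule ring_hom_memI) simp_all
    \<comment> \<open>The composite sends \<open>u x y\<close> to \<open>u x (inv g)\<close> times
      \<open>u (inv g) y\<close>, and transitivity removes the base point.\<close>
    show "(\<psi> \<circ> \<phi>) (AG_u G H x y) = id (AG_u G H x y)"
      if "x \<in> carrier G - H" "y \<in> carrier G - H" for x y
      using that g' by (simp add: \<phi> \<psi> R.v_closed R.v'_closed R.notin_subgroup A.v_of_u_def A.u_trans)
  qed
  have surj: "\<psi> ` carrier ?R = carrier ?A"
  proof
    show "carrier ?A \<subseteq> \<psi> ` carrier ?R"
    proof
      fix a assume a: "a \<in> carrier ?A"
      then have "a = \<psi> (\<phi> a)"
        using \<psi>\<phi> by simp
      then show "a \<in> \<psi> ` carrier ?R"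
        using ring_hom_closed[OF \<phi>(1) a] by (rule image_eqI)
    qed
  qed auto
  have vg: "R_v G H g \<in> carrier ?R"
    using g by (simp add: R.v_closed)
  interpret J: ideal J ?R
    unfolding J_def using vg by (intro R.genideal_ideal) simp
  interpret Q: ring "?R Quot J"
    by (rule J.quotient_is_ring)
  interpret \<pi>: ring_hom_ring ?R "?R Quot J" "(+>\<^bsub>?R\<^esub>) J"
    by (rule J.rcos_ring_hom_ring)
  interpret QR: sv_family "?R Quot J" G H "(+>\<^bsub>?R\<^esub>) J \<circ> R_s G H" "(+>\<^bsub>?R\<^esub>) J \<circ> R_v G H" "(+>\<^bsub>?R\<^esub>) J \<circ> R_v' G H"
    by (rule R.image[OF Q.ring_axioms J.rcos_ring_hom])
  have "\<one>\<^bsub>?R\<^esub> \<ominus>\<^bsub>?R\<^esub> R_v G H g \<in> J"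
    unfolding J_def using vg by (intro R.genideal_self') simp
  \<comment> \<open>Modulo \<open>J\<close> the element \<open>R_v G H g\<close> becomes one, and
    hence so does its inverse.\<close>
  then have \<pi>vg: "J +>\<^bsub>?R\<^esub> R_v G H g = \<one>\<^bsub>?R Quot J\<^esub>"
    using vg R.quotient_eq_iff_same_a_r_cos[OF J.ideal_axioms R.one_closed vg] \<pi>.hom_one by simp
  then have \<pi>v'g: "J +>\<^bsub>?R\<^esub> R_v' G H g = \<one>\<^bsub>?R Quot J\<^esub>"
    using QR.v'_unique[OF assms(5) Q.one_closed] by simp
  have \<psi>vg: "\<psi> (R_v G H g) = \<one>\<^bsub>?A\<^esub>"
    using g by (simp add: \<psi> A.v_of_u_base[OF assms(5)])
  have \<phi>\<psi>: "((+>\<^bsub>?R\<^esub>) J \<circ> (\<phi> \<circ> \<psi>)) r = J +>\<^bsub>?R\<^esub> r" if "r \<in> carrier ?R" for r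
  proof (rule R_ring_hom_unique[OF assms(1,2) Q.ring_axioms
        ring_hom_trans[OF ring_hom_trans[OF \<psi>(1) \<phi>(1)] J.rcos_ring_hom] J.rcos_ring_hom _ g(1) \<pi>vg _ that])
    show "((+>\<^bsub>?R\<^esub>) J \<circ> (\<phi> \<circ> \<psi>)) (R_v G H x) = J +>\<^bsub>?R\<^esub> R_v G H x" if x: "x \<in> carrier G - H" for x
    proof -
      \<comment> \<open>The composite multiplies \<open>v x\<close> by the inverse of
        \<open>v g\<close>, a factor that becomes one modulo \<open>J\<close>.\<close>
      have "\<phi> (\<psi> (R_v G H x)) = R_v G H x \<otimes>\<^bsub>?R\<^esub> R_v' G H g"
        using x g g' by (simp add: \<psi> \<phi> A.v_of_u_def A.notin_subgroup)
      then show ?thesis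
        using x g \<pi>v'g by (simp add: R.v_closed R.v'_closed)
    qed
    show "((+>\<^bsub>?R\<^esub>) J \<circ> (\<phi> \<circ> \<psi>)) (R_v G H g) = \<one>\<^bsub>?R Quot J\<^esub>"
      using \<psi>vg ring_hom_one[OF \<phi>(1)] \<pi>.hom_one by simp
  qed
  have "a_kernel ?R ?A \<psi> = J"
  proof
    show "a_kernel ?R ?A \<psi> \<subseteq> J"
    proof
      fix r assume r: "r \<in> a_kernel ?R ?A \<psi>"
      then have rc: "r \<in> carrier ?R"
        by (simp add: a_kernel_def' del: \<psi>.kernel_zero)
      \<comment> \<open>The coset of \<open>r\<close> is that of \<open>\<phi> (\<psi> r)\<close>,
        which is zero for \<open>r\<close> in the kernel.\<close>
      have "J +>\<^bsub>?R\<^esub> r = J +>\<^bsub>?R\<^esub> \<zero>\<^bsub>?R\<^esub>"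
        using \<phi>\<psi>[OF rc] r ring_hom_zero[OF \<phi>(1) A.ring_axioms R.ring_axioms] by simp
      then show "r \<in> J"
        using rc R.quotient_eq_iff_same_a_r_cos[OF J.ideal_axioms rc R.zero_closed] by (simp add: R.minus_eq)
    qed
    \<comment> \<open>For the other inclusion it suffices that the generator of \<open>J\<close> is
      in the kernel.\<close>
    have "\<psi> (\<one>\<^bsub>?R\<^esub> \<ominus>\<^bsub>?R\<^esub> R_v G H g) = \<zero>\<^bsub>?A\<^esub>"
      using vg \<psi>vg by (simp add: R.minus_eq A.r_neg)
    then have "{\<one>\<^bsub>?R\<^esub> \<ominus>\<^bsub>?R\<^esub> R_v G H g} \<subseteq> a_kernel ?R ?A \<psi>"
      using vg by (simp add: a_kernel_def' del: \<psi>.kernel_zero)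
    then show "J \<subseteq> a_kernel ?R ?A \<psi>"
      unfolding J_def by (intro R.genideal_minimal \<psi>.kernel_is_ideal)
  qed
  then have "?R Quot J \<simeq> ?A"
    using \<psi>.FactRing_iso[OF surj] by simp
  then show ?thesis
    unfolding J_def[symmetric] by (rule ring_iso_sym[OF Q.ring_axioms])
qed

end
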